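(* Let $(X,\|\cdot\|)$ be a complex normed space and let $x,y\in X\setminus\{0\}$. Suppose $\angle(x,y)=\frac{\pi}{2}+ib$ with $b\in\mathbb R$. Then $\angle(ix,y)$ is purely real, and $$\angle(ix,y)=\frac{\pi}{2}-\frac12\operatorname{sgn}(b)\arccos\big[3-2\cosh^2(b)\big]=\frac{\pi}{2}-\frac12\operatorname{sgn}(b)\arccos\big[2-\cosh(2b)\big]=\frac{\pi}{2}-\arcsin[\sinh(b)]=\arccos[\sinh(b)].$$
   Context: Let $(X,\|\cdot\|)$ be a complex normed vector space and let $i$ be the imaginary unit. The product $\langle\cdot\,|\,\cdot\rangle:X\times X\to\mathbb C$ is defined as follows: $\langle x|y\rangle:=0$ if $x=0$ or $y=0$, and otherwise $$\langle x|y\rangle:=\|x\|\,\|y\|\cdot\tfrac14\Big[\big\|\tfrac{x}{\|x\|}+\tfrac{y}{\|y\|}\big\|^2-\big\|\tfrac{x}{\|x\|}-\tfrac{y}{\|y\|}\big\|^2+i\Big(\big\|\tfrac{x}{\|x\|}+i\tfrac{y}{\|y\|}\big\|^2-\big\|\tfrac{x}{\|x\|}-i\tfrac{y}{\|y\|}\big\|^2\Big)\Big].$$ Let $\mathcal A:=\{a+ib\mid 0<a<\pi,\ b\in\mathbb R\}\cup\{0,\pi\}$ and $\mathcal B:=\mathbb C\setminus\{r\in\mathbb R\mid r<-1\text{ or }r>1\}$. The complex cosine restricts to a homeomorphism $\cos:\mathcal A\to\mathcal B$, and $\arccos:\mathcal B\to\mathcal A$ denotes its inverse (on $[-1,1]$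 it is the usual real arccosine). For $x,y\in X\setminus\{0\}$ the angle is the complex number $\angle(x,y):=\arccos\big(\langle x|y\rangle/(\|x\|\,\|y\|)\big)\in\mathcal A$ (the argument always lies in $\mathcal B$). In the formula for $\angle(ix,y)$ the functions $\arccos,\arcsin$ are the real ones on $[-1,1]$, and $\operatorname{sgn}(0)=0$, $\operatorname{sgn}(t)=1$ for $t>0$, $\operatorname{sgn}(t)=-1$ for $t<0$. *)

theory Defs
  imports "HOL-Analysis.Analysis"
begin

text \<open>
  Complex normed spaces. The parent class only contributes data determined by the norm and the
  complex scalar multiplication: \<open>scaleR_scaleC\<close> forces the real scalar multiplication to
  be the restriction of the complex one, and distance and topology are those of the norm.
\<close>

class complex_normed_vector = real_normed_vector +
  fixes scaleC :: "complex \<Rightarrow> 'a \<Rightarrow> 'a"  (infixr \<open>*\<^sub>C\<close> 75)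
  assumes scaleC_add_right: "c *\<^sub>C (x + y) = c *\<^sub>C x + c *\<^sub>C y"
    and scaleC_add_left: "(c + d) *\<^sub>C x = c *\<^sub>C x + d *\<^sub>C x"
    and scaleC_scaleC: "c *\<^sub>C d *\<^sub>C x = (c * d) *\<^sub>C x"
    and scaleC_one: "1 *\<^sub>C x = x"
    and norm_scaleC: "norm (c *\<^sub>C x) = cmod c * norm x"
    and scaleR_scaleC: "r *\<^sub>R x = complex_of_real r *\<^sub>C x"

instantiation complex :: complex_normed_vector
begin

definition scaleC_complex :: "complex \<Rightarrow> complex \<Rightarrow> complex" where
  "scaleC_complex c x = c * x"

instance
  by standard (simp_all add: scaleC_complex_def algebra_simps norm_mult scaleR_conv_of_real)

end

lemma vector_space_scaleC: "vector_space (scaleC :: complex \<Rightarrow> 'a \<Rightarrow> 'a::complex_normed_vector)"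
  by unfold_locales (simp_all add: scaleC_add_right scaleC_add_left scaleC_scaleC scaleC_one)

definition normalized :: "'a::real_normed_vector \<Rightarrow> 'a" where
  "normalized x = (1 / norm x) *\<^sub>R x"

definition cproduct :: "'a::complex_normed_vector \<Rightarrow> 'a \<Rightarrow> complex" where
  "cproduct x y =
     (if x = 0 \<or> y = 0 then 0
      else complex_of_real (norm x) * complex_of_real (norm y) * (1 / 4) *
        (complex_of_real ((norm (normalized x + normalized y))\<^sup>2
                          - (norm (normalized x - normalized y))\<^sup>2)
         + \<i> * complex_of_real ((norm (normalized x + \<i> *\<^sub>C normalized y))\<^sup>2
                          - (norm (normalized x - \<i> *\<^sub>C normalized y))\<^sup>2)))"

definition angle_values :: "complex set" where
  "angle_values = {z. 0 < Re z \<and> Re z < pi} \<union> {0, complex_of_real pi}"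

definition cos_values :: "complex set" where
  "cos_values = UNIV - complex_of_real ` {r. r < - 1 \<or> r > 1}"

definition carccos :: "complex \<Rightarrow> complex" where
  "carccos = the_inv_into angle_values cos"

definition angle :: "'a::complex_normed_vector \<Rightarrow> 'a \<Rightarrow> complex" where
  "angle x y = carccos (cproduct x y / (complex_of_real (norm x) * complex_of_real (norm y)))"

lemma Arccos_cos_angle_values: "z \<in> angle_values \<Longrightarrow> Arccos (cos z) = z"
  by (rule Arccos_cos) (auto simp: angle_values_def)

lemma cos_values_iff: "w \<in> cos_values \<longleftrightarrow> (Im w = 0 \<longrightarrow> \<bar>Re w\<bar> \<le> 1)"
proof -
  have "w \<in> complex_of_real ` {r. r < - 1 \<or> r > 1} \<longleftrightarrow> Im w = 0 \<and> (Re w < -1 \<or> Re w > 1)"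
    by (auto simp: image_iff complex_eq_iff)
  thus ?thesis
    by (auto simp: cos_values_def)
qed

lemma bij_betw_cos: "bij_betw cos angle_values cos_values"
  unfolding bij_betw_def
proof (intro conjI subset_antisym subsetI)
  show "inj_on cos angle_values"
    by (metis Arccos_cos_angle_values inj_onI)
next
  fix w assume "w \<in> cos ` angle_values"
  then obtain z where z: "z \<in> angle_values" "w = cos z" by blast
  have "\<bar>Re w\<bar> \<le> 1" if "Im w = 0"
  proof -
    have "sin (Re z) = 0 \<or> Im z = 0"
      using that by (simp add: z(2) Im_cos)
    moreover have "sin (Re z) \<noteq> 0" if "0 < Re z" "Re z < pi"
      using sin_gt_zero[OF that] by simp
    ultimately have "Im z = 0"
      using z(1) by (auto simp: angle_values_def)
    thus ?thesis by (simp add: z(2) Re_cos)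
  qed
  thus "w \<in> cos_values" by (simp add: cos_values_iff)
next
  fix w assume w: "w \<in> cos_values"
  show "w \<in> cos ` angle_values"
  proof (cases "Im w = 0")
    case True
    hence r: "\<bar>Re w\<bar> \<le> 1" using w by (simp add: cos_values_iff)
    have "w = cos (complex_of_real (arccos (Re w)))"
      using r True by (simp add: cos_of_real complex_eq_iff)
    moreover have "0 \<le> arccos (Re w)" "arccos (Re w) \<le> pi"
      using r by (auto intro: arccos_lbound arccos_ubound)
    hence "complex_of_real (arccos (Re w)) \<in> angle_values"
      by (cases "arccos (Re w) = 0 \<or> arccos (Re w) = pi") (auto simp: angle_values_def)
    ultimately show ?thesis by (rule image_eqI)
  next
    case False
    define z where "z = Arccos w"
    have c: "cos z = w" by (simp add: z_def)
    have b: "- pi < Re z" "Re z \<le> pi" using Re_Arccos_bounds[of w] by (auto simp: z_def)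
    have "sin (Re z) \<noteq> 0" using False by (auto simp: c[symmetric] Im_cos)
    hence "Re z \<noteq> 0" "Re z \<noteq> pi" by auto
    hence "z \<in> angle_values \<or> - z \<in> angle_values"
      using b by (auto simp: angle_values_def)
    thus ?thesis using c by (metis cos_minus image_eqI)
  qed
qed

lemma carccos_of_real: "\<bar>r\<bar> \<le> 1 \<Longrightarrow> carccos (complex_of_real r) = complex_of_real (arccos r)"
proof -
  assume r: "\<bar>r\<bar> \<le> 1"
  have "0 \<le> arccos r" "arccos r \<le> pi"
    using r by (auto intro: arccos_lbound arccos_ubound)
  hence "complex_of_real (arccos r) \<in> angle_values"
    by (cases "arccos r = 0 \<or> arccos r = pi") (auto simp: angle_values_def)
  moreover have "cos (complex_of_real (arccos r)) = complex_of_real r"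
    using r by (simp add: cos_of_real)
  ultimately show ?thesis
    unfolding carccos_def
    by (intro the_inv_into_f_eq bij_betw_imp_inj_on[OF bij_betw_cos])
qed

lemma angle_argument_in_cos_values:
  fixes x y :: "'a::complex_normed_vector"
  assumes "x \<noteq> 0" "y \<noteq> 0"
  shows "cproduct x y / (complex_of_real (norm x) * complex_of_real (norm y)) \<in> cos_values"
proof -
  let ?u = "normalized x" and ?v = "normalized y"
  have n: "norm ?u = 1" "norm ?v = 1" using assms by (simp_all add: normalized_def)
  have "norm (?u + ?v) \<le> 2" "norm (?u - ?v) \<le> 2"
    using norm_triangle_ineq[of ?u ?v] norm_triangle_ineq4[of ?u ?v] n by simp_all
  hence "(norm (?u + ?v))\<^sup>2 \<le> 2\<^sup>2" "(norm (?u - ?v))\<^sup>2 \<le> 2\<^sup>2"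
    by (intro power_mono; simp)+
  moreover have "\<bar>(a - b) / 4\<bar> \<le> 1" if "a \<le> 2\<^sup>2" "b \<le> 2\<^sup>2" "0 \<le> a" "0 \<le> b" for a b :: real
    using that by (auto simp: abs_le_iff)
  ultimately have "\<bar>((norm (?u + ?v))\<^sup>2 - (norm (?u - ?v))\<^sup>2) / 4\<bar> \<le> 1"
    by simp
  moreover have "Re (cproduct x y / (complex_of_real (norm x) * complex_of_real (norm y)))
      = ((norm (?u + ?v))\<^sup>2 - (norm (?u - ?v))\<^sup>2) / 4"
    using assms by (simp add: cproduct_def)
  ultimately show ?thesis by (simp only: cos_values_iff simp_thms)
qed

end

theory Submission
  imports Defs
begin

text \<open>
  Multiplying the first argument by \<open>\<i>\<close> multiplies the normalised product by \<open>\<i>\<close>, because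
  \<open>\<parallel>\<i>u \<plusminus> v\<parallel> = \<parallel>u \<mp> \<i>v\<parallel>\<close>. The normalised product of \<open>x, y\<close> is \<open>cos (\<pi>/2 + \<i>b) = -\<i> sinh b\<close>, so
  that of \<open>\<i>x, y\<close> is the real number \<open>sinh b\<close>, and its modulus is at most 1. The formulas
  with \<open>sgn\<close> are the half-angle identity \<open>arccos (1 - 2s\<^sup>2) = 2 arcsin \<bar>s\<bar>\<close> at \<open>s = sinh b\<close>.
\<close>

text \<open>Pull out the factor \<open>\<i>\<close>, which has modulus 1, and use
  \<open>\<i> * \<i> = -1\<close>.\<close>

lemma norm_ii_scaleC_add:
  fixes u v :: "'a::complex_normed_vector"
  shows "norm (\<i> *\<^sub>C u + v) = norm (u - \<i> *\<^sub>C v)"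
proof -
  interpret vector_space "scaleC :: complex \<Rightarrow> 'a \<Rightarrow> 'a" by (rule vector_space_scaleC)
  have "\<i> *\<^sub>C (u - \<i> *\<^sub>C v) = \<i> *\<^sub>C u + v"
    by (simp add: scale_right_diff_distrib)
  then show ?thesis
    using norm_scaleC[of \<i> "u - \<i> *\<^sub>C v"] by simp
qed

lemma norm_ii_scaleC_diff:
  fixes u v :: "'a::complex_normed_vector"
  shows "norm (\<i> *\<^sub>C u - v) = norm (u + \<i> *\<^sub>C v)"
proof -
  interpret vector_space "scaleC :: complex \<Rightarrow> 'a \<Rightarrow> 'a" by (rule vector_space_scaleC)
  show ?thesis
    using norm_ii_scaleC_add[of u "- v"] by simp
qed

lemma normalized_ii_scaleC:
  fixes x :: "'a::complex_normed_vector"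
  shows "normalized (\<i> *\<^sub>C x) = \<i> *\<^sub>C normalized x"
  by (simp add: normalized_def norm_scaleC scaleR_scaleC scaleC_scaleC mult.commute)

text \<open>Write the bracket in \<open>cproduct x y\<close> as \<open>A + \<i> * B\<close>. The
  norm identities above turn \<open>A\<close> into \<open>- B\<close> and \<open>B\<close> into
  \<open>A\<close>, and \<open>- B + \<i> * A\<close> is
  \<open>\<i> * (A + \<i> * B)\<close>.\<close>

lemma cproduct_ii_scaleC_left:
  fixes x y :: "'a::complex_normed_vector"
  shows "cproduct (\<i> *\<^sub>C x) y = \<i> * cproduct x y"
proof (cases "x = 0 \<or> y = 0")
  case True
  then show ?thesis
    using norm_scaleC[of \<i> x] by (auto simp: cproduct_def)
next
  case False
  interpret vector_space "scaleC :: complex \<Rightarrow> 'a \<Rightarrow> 'a" by (rule vector_space_scaleC)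
  let ?u = "normalized x" and ?v = "normalized y"
  have *: "norm (\<i> *\<^sub>C ?u + \<i> *\<^sub>C ?v) = norm (?u + ?v)"
    "norm (\<i> *\<^sub>C ?u - \<i> *\<^sub>C ?v) = norm (?u - ?v)"
    by (simp_all add: norm_scaleC flip: scale_right_distrib scale_right_diff_distrib)
  have "\<i> *\<^sub>C x \<noteq> 0"
    using False by simp
  then show ?thesis
    using False
    by (simp add: cproduct_def normalized_ii_scaleC norm_ii_scaleC_add norm_ii_scaleC_diff *
        norm_scaleC complex_eq_iff) (simp add: algebra_simps)
qed

text \<open>Turns a hypothesis on the angle into a value of the product: the quotient lies in
  \<open>cos_values\<close>, where \<open>carccos\<close> is a right inverse of
  \<open>cos\<close>.\<close>

lemma cos_angle:
  fixes x y :: "'a::complex_normed_vector"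
  assumes "x \<noteq> 0" "y \<noteq> 0"
  shows "cos (angle x y) = cproduct x y / (complex_of_real (norm x) * complex_of_real (norm y))"
  unfolding angle_def carccos_def
  by (rule f_the_inv_into_f_bij_betw[OF bij_betw_cos])
    (simp add: angle_argument_in_cos_values[OF assms])

text \<open>Double-angle formula for \<open>cos\<close>; the absolute value keeps
  \<open>2 * arcsin \<bar>s\<bar>\<close> in the range [0, \<pi>] of \<open>arccos\<close>.\<close>

lemma arccos_one_minus_two_squares:
  assumes "\<bar>s\<bar> \<le> 1"
  shows "arccos (1 - 2 * s\<^sup>2) = 2 * arcsin \<bar>s\<bar>"
proof -
  have "cos (2 * arcsin \<bar>s\<bar>) = 1 - 2 * s\<^sup>2"
    using assms by (simp add: cos_double_sin)
  moreover have "0 \<le> arcsin \<bar>s\<bar>" "arcsin \<bar>s\<bar> \<le> pi / 2"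
    using assms arcsin_le_arcsin[of 0 "\<bar>s\<bar>"] arcsin_ubound[of "\<bar>s\<bar>"] by auto
  ultimately show ?thesis
    using arccos_cos[of "2 * arcsin \<bar>s\<bar>"] by simp
qed

theorem corollary1p6:
  fixes x y :: "'a::complex_normed_vector" and b :: real
  assumes "x \<noteq> 0" and "y \<noteq> 0"
    and "angle x y = complex_of_real (pi / 2) + \<i> * complex_of_real b"
  shows "angle (\<i> *\<^sub>C x) y \<in> \<real>
    \<and> 3 - 2 * (cosh b)\<^sup>2 \<in> {-1..1} \<and> 2 - cosh (2 * b) \<in> {-1..1} \<and> sinh b \<in> {-1..1}
    \<and> angle (\<i> *\<^sub>C x) y = complex_of_real (pi / 2 - 1 / 2 * sgn b * arccos (3 - 2 * (cosh b)\<^sup>2))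
    \<and> pi / 2 - 1 / 2 * sgn b * arccos (3 - 2 * (cosh b)\<^sup>2)
        = pi / 2 - 1 / 2 * sgn b * arccos (2 - cosh (2 * b))
    \<and> pi / 2 - 1 / 2 * sgn b * arccos (2 - cosh (2 * b)) = pi / 2 - arcsin (sinh b)
    \<and> pi / 2 - arcsin (sinh b) = arccos (sinh b)"
proof -
  have nx: "norm (\<i> *\<^sub>C x) = norm x" and ix: "\<i> *\<^sub>C x \<noteq> 0"
    using norm_scaleC[of \<i> x] assms(1) by auto
  define q where
    "q = cproduct (\<i> *\<^sub>C x) y / (complex_of_real (norm (\<i> *\<^sub>C x)) * complex_of_real (norm y))"
  have "q = \<i> * cos (angle x y)"
    by (simp add: q_def cos_angle[OF assms(1,2)] cproduct_ii_scaleC_left nx)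
  also have "\<dots> = complex_of_real (sinh b)"
    by (simp add: assms(3) complex_eq_iff Re_cos Im_cos sinh_field_def exp_minus field_simps power2_eq_square)
  finally have q: "q = complex_of_real (sinh b)" .
  \<comment> \<open>The bound on \<open>sinh b\<close> comes from the norm: a real element of
    \<open>cos_values\<close> lies in [-1, 1].\<close>
  have "q \<in> cos_values"
    unfolding q_def by (rule angle_argument_in_cos_values[OF ix assms(2)])
  then have s: "\<bar>sinh b\<bar> \<le> 1"
    by (simp add: q cos_values_iff)
  have ang: "angle (\<i> *\<^sub>C x) y = complex_of_real (arccos (sinh b))"
    using carccos_of_real[OF s] by (simp add: angle_def q flip: q_def)
  \<comment> \<open>Both \<open>arccos\<close> arguments of the claim are the same number.\<close>
  have c1: "3 - 2 * (cosh b)\<^sup>2 = 1 - 2 * (sinh b)\<^sup>2"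
    by (simp add: cosh_square_eq)
  have c2: "2 - cosh (2 * b) = 1 - 2 * (sinh b)\<^sup>2"
    by (simp add: cosh_double cosh_square_eq)
  have "(sinh b)\<^sup>2 \<le> 1"
    using s by (simp add: abs_square_le_1)
  then have r: "1 - 2 * (sinh b)\<^sup>2 \<in> {-1..1}"
    by simp
  have "1 / 2 * sgn b * arccos (1 - 2 * (sinh b)\<^sup>2) = sgn b * arcsin \<bar>sinh b\<bar>"
    by (simp add: arccos_one_minus_two_squares[OF s])
  \<comment> \<open>\<open>sinh b\<close> has the sign of \<open>b\<close> and \<open>arcsin\<close>
    is odd; at \<open>b = 0\<close> both sides vanish.\<close>
  also have "\<dots> = arcsin (sinh b)"
  proof (cases b "0::real" rule: linorder_cases)
    case less
    have "arcsin (- sinh b) = - arcsin (sinh b)"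
      using s by (intro arcsin_minus) (auto simp: abs_le_iff)
    with less show ?thesis by simp
  qed simp_all
  finally have half: "1 / 2 * sgn b * arccos (1 - 2 * (sinh b)\<^sup>2) = arcsin (sinh b)" .
  have "arccos (sinh b) = pi / 2 - arcsin (sinh b)"
    using s by (simp add: arccos_arcsin_eq abs_le_iff)
  then show ?thesis
    unfolding c1 c2 half ang using s r by (auto simp: abs_le_iff)
qed

end
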